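(* Let $p\in\{0\}\cup[1,\infty)$ and $N\ge2$. There is an $\mathcal{AW}_p$-Cauchy sequence $\mu_n\in\mathcal{P}_p(\mathbb{R}^N)$, $n\ge1$, which is not a $\mathcal{KR}_p$-Cauchy sequence but contains two $\mathcal{KR}_p$-Cauchy sequences.
   Context: $\lambda$ is Lebesgue measure on $(0,1)$ and $\lambda^N$ the product measure on $(0,1)^N$; $T_\#\rho$ denotes the push-forward of a measure $\rho$ under a map $T$. For $p\in[1,\infty)$, $|x|_p^p:=\sum_i|x_i|^p$ and $\mathcal{P}_p(\mathbb{R}^N)$ is the set of Borel probability measures on $\mathbb{R}^N$ with finite $p$-th moment; $\mathcal{P}_0(\mathbb{R}^N)$ is the set of all Borel probability measures on $\mathbb{R}^N$. $|\cdot|$ without index is a fixed norm on $\mathbb{R}^N$ (e.g. the Euclidean norm). A (measurable) map $Q=(Q_k)_{k=1}^N:(0,1)^N\to\mathbb{R}^N$ is triangular if each $Q_k$ depends only on the first $k$ variables, and a triangular $Q$ is a quantile process if for all $k\le m\le N$ and $u_1,\dots,u_m,u_k'\in(0,1)$ with $u_k\le u_k'$: (inc) $Q_k(u_1,\dots,u_k)\le Q_k(u_1,\dots,u_{k-1},u_k')$; (con) if $Q_k(u_1,\dots,u_k)=Q_k(u_1,\dots,u_{k-1},u_k')$ then $Q_m(u_1,\dots,u_k,\dots,u_m)=Q_m(u_1,\dots,u_k',\dots,u_m)$. For every $\mu\in\mathcal{P}_0(\mathbb{R}^N)$ there is a $\lambda^N$-a.s. unique quantile process $Q^\mu$ with $Q^\mu_\#\lambda^N=\mu$.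 Explicitly, writing $\mu(dx)=\mu_1(dx_1)\mu_2^{x_1}(dx_2)\cdots\mu_N^{x_1,\dots,x_{N-1}}(dx_N)$ for the successive disintegration, $Q^\mu_k(u_1,\dots,u_k)$ is the value at $u_k$ of the quantile function (the a.s. unique increasing map on $(0,1)$ pushing $\lambda$ to the given law on $\mathbb{R}$) of $\mu_k^{Q^\mu_1(u_1),\dots,Q^\mu_{k-1}(u_1,\dots,u_{k-1})}$. The Knothe–Rosenblatt distance is $\mathcal{KR}_p(\mu,\nu):=\big(\int|Q^\mu-Q^\nu|_p^p\,d\lambda^N\big)^{1/p}$ for $p\ge1$ and $\mathcal{KR}_0(\mu,\nu):=\int(|Q^\mu-Q^\nu|\wedge1)\,d\lambda^N$. A coupling $\pi$ of $\mu$ and $\nu$ is bicausal, $\pi\in\Pi_{\rm bc}(\mu,\nu)$, if its successive disintegration $\pi=\pi_1(dx_1,dy_1)\,\pi_2^{x_1,y_1}(dx_2,dy_2)\cdots$ satisfies, $\pi$-a.s. and for all $k\le N$, that $\pi_k^{x_1,\dots,x_{k-1},y_1,\dots,y_{k-1}}$ is a coupling of $\mu_k^{x_1,\dots,x_{k-1}}$ and $\nu_k^{y_1,\dots,y_{k-1}}$. The adapted Wasserstein distance is $\mathcal{AW}_p(\mu,\nu):=\inf_{\pi\in\Pi_{\rm bc}(\mu,\nu)}\big(\int|x-y|_p^p\,d\pi\big)^{1/p}$ for $p\ge1$ and $\mathcal{AW}_0(\mu,\nu):=\inf_{\pi\in\Pi_{\rm bc}(\mu,\nu)}\int(|x-y|\wedge1)\,d\pi$.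 *)

theory Defs
  imports "HOL-Probability.Probability"
begin

text \<open>
  Coordinates are numbered from 0, so a vector in \<open>\<real>\<^sup>N\<close> is an element of
  \<open>space (Rn N)\<close>, i.e. an extensional function on \<open>{..<N}\<close>, and its first \<open>k\<close> coordinates are
  \<open>restrict x {..<k} \<in> space (Rn k)\<close>. In particular \<open>Rn 0\<close> has exactly one point.
\<close>

abbreviation Rn :: "nat \<Rightarrow> (nat \<Rightarrow> real) measure" where
  "Rn N \<equiv> PiM {..<N} (\<lambda>_. borel)"

definition is_norm :: "nat \<Rightarrow> ((nat \<Rightarrow> real) \<Rightarrow> real) \<Rightarrow> bool" where
  "is_norm N nrm \<longleftrightarrow>
     (\<forall>x\<in>space (Rn N). nrm x = 0 \<longleftrightarrow> (\<forall>i<N. x i = 0)) \<and>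
     (\<forall>c. \<forall>x\<in>space (Rn N). nrm (\<lambda>i\<in>{..<N}. c * x i) = \<bar>c\<bar> * nrm x) \<and>
     (\<forall>x\<in>space (Rn N). \<forall>y\<in>space (Rn N). nrm (\<lambda>i\<in>{..<N}. x i + y i) \<le> nrm x + nrm y)"

text \<open>The integrand: \<open>|x - y| \<and> 1\<close> for \<open>p = 0\<close> and \<open>|x - y|\<^sub>p\<^sup>p\<close> for \<open>p \<ge> 1\<close>.\<close>

definition cost :: "nat \<Rightarrow> ((nat \<Rightarrow> real) \<Rightarrow> real) \<Rightarrow> real \<Rightarrow> (nat \<Rightarrow> real) \<Rightarrow> (nat \<Rightarrow> real) \<Rightarrow> real" where
  "cost N nrm p x y =
     (if p = 0 then min (nrm (\<lambda>i\<in>{..<N}. x i - y i)) 1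
      else (\<Sum>i<N. \<bar>x i - y i\<bar> powr p))"

text \<open>
  The exponent \<open>1/p\<close> on \<open>[0,\<infinity>]\<close>; no root is taken for \<open>p = 0\<close>. Distances are valued in
  \<open>ennreal\<close>, so that a divergent integral is not silently replaced by 0.
\<close>

definition cost_root :: "real \<Rightarrow> ennreal \<Rightarrow> ennreal" where
  "cost_root p a =
     (if p = 0 then a else if a = \<infinity> then \<infinity> else ennreal (enn2real a powr (1 / p)))"

definition prob_p :: "nat \<Rightarrow> real \<Rightarrow> (nat \<Rightarrow> real) measure set" where
  "prob_p N p = {\<mu>. sets \<mu> = sets (Rn N) \<and> prob_space \<mu> \<and>
     (p \<noteq> 0 \<longrightarrow> (\<integral>\<^sup>+x. ennreal (\<Sum>i<N. \<bar>x i\<bar> powr p) \<partial>\<mu>) < \<infinity>)}"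

definition unif_cube :: "nat \<Rightarrow> (nat \<Rightarrow> real) measure" where
  "unif_cube N = PiM {..<N} (\<lambda>_. restrict_space lborel {0<..<1})"

definition triangular :: "nat \<Rightarrow> ((nat \<Rightarrow> real) \<Rightarrow> (nat \<Rightarrow> real)) \<Rightarrow> bool" where
  "triangular N Q \<longleftrightarrow> Q \<in> unif_cube N \<rightarrow>\<^sub>M Rn N \<and>
     (\<forall>k<N. \<forall>u\<in>space (unif_cube N). \<forall>v\<in>space (unif_cube N).
        (\<forall>i\<le>k. u i = v i) \<longrightarrow> Q u k = Q v k)"

definition quantile_process :: "nat \<Rightarrow> ((nat \<Rightarrow> real) \<Rightarrow> (nat \<Rightarrow> real)) \<Rightarrow> bool" where
  "quantile_process N Q \<longleftrightarrow> triangular N Q \<and>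
     (\<forall>k m. k \<le> m \<longrightarrow> m < N \<longrightarrow>
        (\<forall>u\<in>space (unif_cube N). \<forall>t\<in>{0<..<1}. u k \<le> t \<longrightarrow>
           Q u k \<le> Q (u(k := t)) k \<and>
           (Q u k = Q (u(k := t)) k \<longrightarrow> Q u m = Q (u(k := t)) m)))"

text \<open>
  For every probability measure on \<open>\<real>\<^sup>N\<close> such a process exists and is unique up to
  \<open>unif_cube N\<close>-null sets, so the choice of version is immaterial in \<open>KR\<close>.
\<close>

definition quantile_of :: "nat \<Rightarrow> (nat \<Rightarrow> real) measure \<Rightarrow> (nat \<Rightarrow> real) \<Rightarrow> (nat \<Rightarrow> real)" where
  "quantile_of N \<mu> = (SOME Q. quantile_process N Q \<and> distr (unif_cube N) (Rn N) Q = \<mu>)"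

definition KR :: "nat \<Rightarrow> ((nat \<Rightarrow> real) \<Rightarrow> real) \<Rightarrow> real \<Rightarrow>
    (nat \<Rightarrow> real) measure \<Rightarrow> (nat \<Rightarrow> real) measure \<Rightarrow> ennreal" where
  "KR N nrm p \<mu> \<nu> =
     cost_root p (\<integral>\<^sup>+u. ennreal (cost N nrm p (quantile_of N \<mu> u) (quantile_of N \<nu> u)) \<partial>unif_cube N)"

definition couplings :: "'a measure \<Rightarrow> 'b measure \<Rightarrow> ('a \<times> 'b) measure set" where
  "couplings \<mu> \<nu> =
     {\<pi>. sets \<pi> = sets (\<mu> \<Otimes>\<^sub>M \<nu>) \<and> distr \<pi> \<mu> fst = \<mu> \<and> distr \<pi> \<nu> snd = \<nu>}"

text \<open>
  \<open>K k\<close> is the conditional law of coordinate \<open>k\<close> given the coordinates before it: the law of the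
  first \<open>k + 1\<close> coordinates is the law of the first \<open>k\<close> coordinates composed with \<open>K k\<close>.
\<close>

definition disintegration ::
    "nat \<Rightarrow> (nat \<Rightarrow> real) measure \<Rightarrow> (nat \<Rightarrow> (nat \<Rightarrow> real) \<Rightarrow> real measure) \<Rightarrow> bool" where
  "disintegration N \<mu> K \<longleftrightarrow> (\<forall>k<N.
     K k \<in> Rn k \<rightarrow>\<^sub>M prob_algebra borel \<and>
     distr \<mu> (Rn (Suc k)) (\<lambda>x. restrict x {..<Suc k}) =
       distr \<mu> (Rn k) (\<lambda>x. restrict x {..<k}) \<bind>
         (\<lambda>x. distr (K k x) (Rn (Suc k)) (\<lambda>s. x(k := s))))"

definition disintegration2 ::
    "nat \<Rightarrow> ((nat \<Rightarrow> real) \<times> (nat \<Rightarrow> real)) measure \<Rightarrow>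
     (nat \<Rightarrow> (nat \<Rightarrow> real) \<times> (nat \<Rightarrow> real) \<Rightarrow> (real \<times> real) measure) \<Rightarrow> bool" where
  "disintegration2 N \<pi> K \<longleftrightarrow> (\<forall>k<N.
     K k \<in> Rn k \<Otimes>\<^sub>M Rn k \<rightarrow>\<^sub>M prob_algebra (borel \<Otimes>\<^sub>M borel) \<and>
     distr \<pi> (Rn (Suc k) \<Otimes>\<^sub>M Rn (Suc k)) (\<lambda>(x, y). (restrict x {..<Suc k}, restrict y {..<Suc k})) =
       distr \<pi> (Rn k \<Otimes>\<^sub>M Rn k) (\<lambda>(x, y). (restrict x {..<k}, restrict y {..<k})) \<bind>
         (\<lambda>(x, y). distr (K k (x, y)) (Rn (Suc k) \<Otimes>\<^sub>M Rn (Suc k)) (\<lambda>(s, t). (x(k := s), y(k := t)))))"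

text \<open>
  Disintegrations exist and are unique almost surely, so it does not matter whether the kernels
  are quantified existentially or universally.
\<close>

definition bicausal_couplings ::
    "nat \<Rightarrow> (nat \<Rightarrow> real) measure \<Rightarrow> (nat \<Rightarrow> real) measure \<Rightarrow>
     ((nat \<Rightarrow> real) \<times> (nat \<Rightarrow> real)) measure set" where
  "bicausal_couplings N \<mu> \<nu> = {\<pi> \<in> couplings \<mu> \<nu>.
     \<exists>K K\<mu> K\<nu>. disintegration2 N \<pi> K \<and> disintegration N \<mu> K\<mu> \<and> disintegration N \<nu> K\<nu> \<and>
       (\<forall>k<N. AE (x, y) in \<pi>.
          K k (restrict x {..<k}, restrict y {..<k}) \<in>
            couplings (K\<mu> k (restrict x {..<k})) (K\<nu> k (restrict y {..<k})))}"

definition AW :: "nat \<Rightarrow> ((nat \<Rightarrow> real) \<Rightarrow> real) \<Rightarrow> real \<Rightarrow>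
    (nat \<Rightarrow> real) measure \<Rightarrow> (nat \<Rightarrow> real) measure \<Rightarrow> ennreal" where
  "AW N nrm p \<mu> \<nu> =
     (INF \<pi>\<in>bicausal_couplings N \<mu> \<nu>. cost_root p (\<integral>\<^sup>+(x, y). ennreal (cost N nrm p x y) \<partial>\<pi>))"

definition cauchy_wrt :: "('a \<Rightarrow> 'a \<Rightarrow> ennreal) \<Rightarrow> (nat \<Rightarrow> 'a) \<Rightarrow> bool" where
  "cauchy_wrt d X \<longleftrightarrow> (\<forall>\<epsilon>>0. \<exists>M. \<forall>m\<ge>M. \<forall>n\<ge>M. d (X m) (X n) < ennreal \<epsilon>)"

end

theory Submission
  imports Defs
begin

text \<open>
  Consider two equally likely atoms, with first coordinates 0 and \<open>e > 0\<close>, and let their second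
  coordinates be 0 and 1 in one of the two possible orders. For small \<open>e\<close> the two orders are close in
  the adapted Wasserstein distance: the first coordinate already identifies the atom, so
  matching the atoms with equal second coordinate is bicausal and costs only \<open>e\<close>. The quantile
  process instead matches the atoms according to their first coordinate, however small \<open>e\<close> is,
  so the second coordinates of the two orders always differ by 1. Let \<open>e\<close> tend to 0 and alternate between the orders.
\<close>

section \<open>Two-point laws and gluing with coin-driven kernels\<close>

abbreviation coin :: "bool measure" where
  "coin \<equiv> measure_pmf (pmf_of_set UNIV)"

text \<open>Indexing the atoms by a coin makes couplings easy to write down: two such laws are
  coupled by letting them share the coin.\<close>

definition two_point :: "nat \<Rightarrow> (bool \<Rightarrow> nat \<Rightarrow> real) \<Rightarrow> (nat \<Rightarrow> real) measure" where
  "two_point N \<xi> = distr coin (Rn N) \<xi>"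

lemma sets_two_point [simp, measurable_cong]: "sets (two_point N \<xi>) = sets (Rn N)"
  by (simp add: two_point_def)

text \<open>A fair coin keeps its law when it is flipped, so the labels of the atoms are immaterial.
  This freedom later allows atoms to be matched by their second coordinate.\<close>

lemma two_point_Not: "two_point N (\<lambda>c. \<xi> (\<not> c)) = two_point N \<xi>" if "range \<xi> \<subseteq> space (Rn N)"
proof -
  have "map_pmf Not (pmf_of_set UNIV) = pmf_of_set UNIV"
    by (rule map_pmf_of_set_bij_betw[OF involuntory_imp_bij]) simp_all
  then have "distr coin (count_space UNIV) Not = coin"
    by (simp flip: map_pmf_rep_eq)
  moreover have "distr (distr coin (count_space UNIV) Not) (Rn N) \<xi> = distr coin (Rn N) (\<xi> \<circ> Not)"
    using that by (intro distr_distr) auto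
  ultimately show ?thesis
    by (simp add: two_point_def comp_def)
qed

text \<open>The gluing step when the past \<open>f c\<close> already determines the next value
  \<open>s c\<close>: pulled back to the coin, the kernel is a Dirac mass, and binding Dirac masses
  is a push-forward.\<close>

lemma distr_coin_bind_return:
  assumes f: "f \<in> coin \<rightarrow>\<^sub>M X" and \<kappa>: "\<kappa> \<in> X \<rightarrow>\<^sub>M prob_algebra S"
    and h: "(\<lambda>(x, s). h x s) \<in> X \<Otimes>\<^sub>M S \<rightarrow>\<^sub>M Y"
    and s: "\<And>c. s c \<in> space S" and eq: "\<And>c. \<kappa> (f c) = return S (s c)"
  shows "distr coin X f \<bind> (\<lambda>x. distr (\<kappa> x) Y (h x)) = distr coin Y (\<lambda>c. h (f c) (s c))"
proof -
  have fX: "f c \<in> space X" for c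
    using measurable_space[OF f] by simp
  have hf: "h (f c) \<in> S \<rightarrow>\<^sub>M Y" for c
    using measurable_compose[OF measurable_Pair1'[OF fX] h] by simp
  have "distr coin X f \<bind> (\<lambda>x. distr (\<kappa> x) Y (h x))
      = coin \<bind> (\<lambda>c. distr (\<kappa> (f c)) Y (h (f c)))"
    by (rule bind_distr[OF f measurable_distr2[OF h measurable_prob_algebraD[OF \<kappa>]]]) simp
  also have "\<dots> = coin \<bind> (\<lambda>c. return Y (h (f c) (s c)))"
    unfolding eq by (simp add: distr_return[OF hf s])
  also have "\<dots> = distr coin Y (\<lambda>c. h (f c) (s c))"
    using measurable_space[OF hf s] by (intro bind_return_distr') auto
  finally show ?thesis .
qed

text \<open>The gluing step for the first coordinate: the past is a single point \<open>x\<close>,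
  so the outer coin is integrated out and the randomness comes from the kernel alone.\<close>

lemma distr_coin_bind_const:
  assumes f: "f \<in> coin \<rightarrow>\<^sub>M X" and \<kappa>: "\<kappa> \<in> X \<rightarrow>\<^sub>M prob_algebra S"
    and h: "(\<lambda>(x, s). h x s) \<in> X \<Otimes>\<^sub>M S \<rightarrow>\<^sub>M Y"
    and s: "s \<in> coin \<rightarrow>\<^sub>M S" and x: "\<And>c. f c = x" and eq: "\<kappa> x = distr coin S s"
  shows "distr coin X f \<bind> (\<lambda>x. distr (\<kappa> x) Y (h x)) = distr coin Y (\<lambda>c. h (f c) (s c))"
proof -
  have xX: "x \<in> space X"
    using measurable_space[OF f] x by simp
  have hx: "h x \<in> S \<rightarrow>\<^sub>M Y"
    using measurable_compose[OF measurable_Pair1'[OF xX] h] by simp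
  have "distr coin X f \<bind> (\<lambda>x. distr (\<kappa> x) Y (h x)) = coin \<bind> (\<lambda>c. distr (\<kappa> (f c)) Y (h (f c)))"
    by (rule bind_distr[OF f measurable_distr2[OF h measurable_prob_algebraD[OF \<kappa>]]]) simp
  also have "\<dots> = coin \<bind> (\<lambda>_. distr (distr coin S s) Y (h x))"
    by (simp only: x eq)
  also have "\<dots> = distr (distr coin S s) Y (h x)"
    using hx s
    by (intro bind_const' prob_space_imp_subprob_space prob_space.prob_space_distr
        measure_pmf.prob_space_distr measure_pmf.prob_space_axioms) auto
  also have "\<dots> = distr coin Y (\<lambda>c. h (f c) (s c))"
    unfolding x using hx s by (simp add: distr_distr comp_def)
  finally show ?thesis .
qed

section \<open>Successive disintegrations of two-point laws and of their shared-coin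
  coupling\<close>

lemma restrict_Suc_eq_fun_upd: "restrict x {..<Suc k} = (restrict x {..<k})(k := x k)"
  by (auto simp: fun_eq_iff less_Suc_eq)

lemma measurable_append:
  "(\<lambda>(x, s). x(k := s)) \<in> Rn k \<Otimes>\<^sub>M borel \<rightarrow>\<^sub>M Rn (Suc k)"
proof -
  have "(\<lambda>z. (fst z)(k := snd z)) \<in> Rn k \<Otimes>\<^sub>M (borel :: real measure) \<rightarrow>\<^sub>M Rn (Suc k)"
    by (rule measurable_fun_upd[where J="{..<k}"]) auto
  then show ?thesis by (simp add: case_prod_unfold)
qed

lemma measurable_append2:
  "(\<lambda>(z, w). ((fst z)(k := fst w), (snd z)(k := snd w)))
     \<in> (Rn k \<Otimes>\<^sub>M Rn k) \<Otimes>\<^sub>M (borel \<Otimes>\<^sub>M borel) \<rightarrow>\<^sub>M Rn (Suc k) \<Otimes>\<^sub>M Rn (Suc k)"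
  unfolding case_prod_unfold
  by (intro measurable_Pair measurable_fun_upd[where J="{..<k}"]) auto

text \<open>After the first coordinate, which identifies the atom, everything is deterministic.\<close>

definition two_point_kernel :: "(bool \<Rightarrow> nat \<Rightarrow> real) \<Rightarrow> nat \<Rightarrow> (nat \<Rightarrow> real) \<Rightarrow> real measure" where
  "two_point_kernel \<xi> k x =
     (if k = 0 then distr coin borel (\<lambda>c. \<xi> c 0) else return borel (\<xi> (x 0 = \<xi> True 0) k))"

text \<open>The shared coin is read off from the first component of the past; on the support of the
  coupling the second component would give the same coin. Values off the support are
  arbitrary.\<close>

definition two_point_kernel2 :: "(bool \<Rightarrow> nat \<Rightarrow> real) \<Rightarrow> (bool \<Rightarrow> nat \<Rightarrow> real) \<Rightarrow> nat \<Rightarrow>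
    (nat \<Rightarrow> real) \<times> (nat \<Rightarrow> real) \<Rightarrow> (real \<times> real) measure" where
  "two_point_kernel2 \<xi> \<eta> k z =
     (if k = 0 then distr coin (borel \<Otimes>\<^sub>M borel) (\<lambda>c. (\<xi> c 0, \<eta> c 0))
      else return (borel \<Otimes>\<^sub>M borel)
        (\<xi> (fst z 0 = \<xi> True 0) k, \<eta> (fst z 0 = \<xi> True 0) k))"

lemma prob_space_distr_coin: "f \<in> coin \<rightarrow>\<^sub>M X \<Longrightarrow> prob_space (distr coin X f)"
  by (rule measure_pmf.prob_space_distr)

lemma measurable_two_point_kernel: "two_point_kernel \<xi> k \<in> Rn k \<rightarrow>\<^sub>M prob_algebra borel"
proof (cases "k = 0")
  case True
  then show ?thesis
    unfolding two_point_kernel_def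
    by (auto simp: space_prob_algebra prob_space_distr_coin)
next
  case False
  have [measurable]: "(\<lambda>x. x 0) \<in> Rn k \<rightarrow>\<^sub>M borel"
    using False by (intro measurable_component_singleton) auto
  have "(\<lambda>x. return borel (if x 0 = \<xi> True 0 then \<xi> True k else \<xi> False k))
      \<in> Rn k \<rightarrow>\<^sub>M prob_algebra borel"
    by measurable
  also have "(\<lambda>x. return borel (if x 0 = \<xi> True 0 then \<xi> True k else \<xi> False k))
      = two_point_kernel \<xi> k"
    using False by (auto simp: two_point_kernel_def fun_eq_iff)
  finally show ?thesis .
qed

lemma measurable_two_point_kernel2:
  "two_point_kernel2 \<xi> \<eta> k \<in> Rn k \<Otimes>\<^sub>M Rn k \<rightarrow>\<^sub>M prob_algebra (borel \<Otimes>\<^sub>M borel)"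
proof (cases "k = 0")
  case True
  then show ?thesis
    unfolding two_point_kernel2_def
    by (auto simp: space_prob_algebra prob_space_distr_coin space_pair_measure)
next
  case False
  have [measurable]: "(\<lambda>x. x 0) \<in> Rn k \<rightarrow>\<^sub>M borel"
    using False by (intro measurable_component_singleton) auto
  have "(\<lambda>z. return (borel \<Otimes>\<^sub>M borel) (if fst z 0 = \<xi> True 0 then (\<xi> True k, \<eta> True k) else (\<xi> False k, \<eta> False k)))
      \<in> Rn k \<Otimes>\<^sub>M Rn k \<rightarrow>\<^sub>M prob_algebra (borel \<Otimes>\<^sub>M borel)"
    by measurable
  also have "(\<lambda>z. return (borel \<Otimes>\<^sub>M borel) (if fst z 0 = \<xi> True 0 then (\<xi> True k, \<eta> True k) else (\<xi> False k, \<eta> False k)))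
      = two_point_kernel2 \<xi> \<eta> k"
    using False by (auto simp: two_point_kernel2_def fun_eq_iff)
  finally show ?thesis .
qed

lemma restrict_in_space_Rn [simp]: "restrict x {..<k} \<in> space (Rn k)"
  by (auto simp: space_PiM)

lemma undefined_in_space_Rn_0 [simp]: "(\<lambda>_. undefined) \<in> space (PiM {} M)" "restrict x {} \<in> space (PiM {} M)"
  by (auto simp: space_PiM restrict_def)

lemma measurable_restrict_Rn: "k \<le> N \<Longrightarrow> (\<lambda>x. restrict x {..<k}) \<in> Rn N \<rightarrow>\<^sub>M Rn k"
  by (rule measurable_restrict_subset) auto

lemma disintegration_two_point:
  assumes \<xi>: "range \<xi> \<subseteq> space (Rn N)" and ne: "\<xi> False 0 \<noteq> \<xi> True 0"
  shows "disintegration N (two_point N \<xi>) (two_point_kernel \<xi>)"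
  unfolding disintegration_def
proof (intro allI impI conjI measurable_two_point_kernel)
  fix k assume k: "k < N"
  have marg: "distr (two_point N \<xi>) (Rn j) (\<lambda>x. restrict x {..<j})
      = distr coin (Rn j) (\<lambda>c. restrict (\<xi> c) {..<j})" if "j \<le> N" for j
    unfolding two_point_def using \<xi> measurable_restrict_Rn[OF that]
    by (subst distr_distr) (auto simp: comp_def)
  have "distr coin (Rn k) (\<lambda>c. restrict (\<xi> c) {..<k}) \<bind>
      (\<lambda>x. distr (two_point_kernel \<xi> k x) (Rn (Suc k)) (\<lambda>s. x(k := s)))
      = distr coin (Rn (Suc k)) (\<lambda>c. (restrict (\<xi> c) {..<k})(k := \<xi> c k))"
  proof (cases "k = 0")
    case True
    \<comment> \<open>The function \<open>\<lambda>_. undefined\<close> is the only point of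
      \<open>Rn 0\<close>, the empty past.\<close>
    show ?thesis
      by (rule distr_coin_bind_const[where x="\<lambda>_. undefined",
            OF _ measurable_two_point_kernel measurable_append])
        (auto simp: True two_point_kernel_def)
  next
    case False
    \<comment> \<open>Distinct first coordinates let the past reveal the coin, so the Dirac kernel
      picks the correct atom.\<close>
    have "(\<xi> c 0 = \<xi> True 0) = c" for c
      using ne by (cases c) auto
    then show ?thesis
      using False
      by (intro distr_coin_bind_return[OF _ measurable_two_point_kernel measurable_append])
        (auto simp: two_point_kernel_def)
  qed
  then show "distr (two_point N \<xi>) (Rn (Suc k)) (\<lambda>x. restrict x {..<Suc k}) =
      distr (two_point N \<xi>) (Rn k) (\<lambda>x. restrict x {..<k}) \<bind>
      (\<lambda>x. distr (two_point_kernel \<xi> k x) (Rn (Suc k)) (\<lambda>s. x(k := s)))"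
    unfolding marg[OF Suc_leI[OF k]] marg[OF less_imp_le[OF k]] unfolding restrict_Suc_eq_fun_upd by (rule sym)
qed

lemma disintegration2_two_point:
  assumes \<xi>: "range \<xi> \<subseteq> space (Rn N)" and \<eta>: "range \<eta> \<subseteq> space (Rn N)" and ne: "\<xi> False 0 \<noteq> \<xi> True 0"
  shows "disintegration2 N (distr coin (Rn N \<Otimes>\<^sub>M Rn N) (\<lambda>c. (\<xi> c, \<eta> c))) (two_point_kernel2 \<xi> \<eta>)"
    (is "disintegration2 N ?\<pi> _")
  unfolding disintegration2_def
proof (intro allI impI conjI measurable_two_point_kernel2)
  fix k assume k: "k < N"
  let ?r = "\<lambda>j. \<lambda>(x, y). (restrict x {..<j}, restrict y {..<j})"
  have marg: "distr ?\<pi> (Rn j \<Otimes>\<^sub>M Rn j) (?r j)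
      = distr coin (Rn j \<Otimes>\<^sub>M Rn j) (\<lambda>c. (restrict (\<xi> c) {..<j}, restrict (\<eta> c) {..<j}))"
    if "j \<le> N" for j
  proof -
    note [measurable] = measurable_restrict_Rn[OF that]
    show ?thesis
      using \<xi> \<eta> by (subst distr_distr) (auto simp: comp_def space_pair_measure)
  qed
  \<comment> \<open>The projections \<open>fst\<close> and \<open>snd\<close> treat the pair of
    pasts as one state, as the gluing lemmas expect; the tuple form is restored by
    \<open>case_prod_unfold\<close>.\<close>
  have "distr coin (Rn k \<Otimes>\<^sub>M Rn k) (\<lambda>c. (restrict (\<xi> c) {..<k}, restrict (\<eta> c) {..<k})) \<bind>
      (\<lambda>z. distr (two_point_kernel2 \<xi> \<eta> k z) (Rn (Suc k) \<Otimes>\<^sub>M Rn (Suc k))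
        (\<lambda>w. ((fst z)(k := fst w), (snd z)(k := snd w))))
      = distr coin (Rn (Suc k) \<Otimes>\<^sub>M Rn (Suc k)) (\<lambda>c.
        ((fst (restrict (\<xi> c) {..<k}, restrict (\<eta> c) {..<k}))(k := fst (\<xi> c k, \<eta> c k)),
         (snd (restrict (\<xi> c) {..<k}, restrict (\<eta> c) {..<k}))(k := snd (\<xi> c k, \<eta> c k))))"
  proof (cases "k = 0")
    case True
    show ?thesis
      by (rule distr_coin_bind_const[where x="(\<lambda>_. undefined, \<lambda>_. undefined)",
            OF _ measurable_two_point_kernel2 measurable_append2])
        (auto simp: True two_point_kernel2_def space_pair_measure)
  next
    case False
    have "(\<xi> c 0 = \<xi> True 0) = c" for c
      using ne by (cases c) auto
    then show ?thesis
      using False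
      by (intro distr_coin_bind_return[OF _ measurable_two_point_kernel2 measurable_append2])
        (auto simp: two_point_kernel2_def space_pair_measure)
  qed
  then show "distr ?\<pi> (Rn (Suc k) \<Otimes>\<^sub>M Rn (Suc k)) (?r (Suc k)) =
      distr ?\<pi> (Rn k \<Otimes>\<^sub>M Rn k) (?r k) \<bind>
      (\<lambda>(x, y). distr (two_point_kernel2 \<xi> \<eta> k (x, y)) (Rn (Suc k) \<Otimes>\<^sub>M Rn (Suc k))
        (\<lambda>(s, t). (x(k := s), y(k := t))))"
    unfolding marg[OF Suc_leI[OF k]] marg[OF less_imp_le[OF k]] unfolding restrict_Suc_eq_fun_upd
    by (simp only: case_prod_unfold fst_conv snd_conv prod.collapse)
qed

section \<open>Bicausality of the shared-coin coupling\<close>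

lemma AE_distr_coin:
  assumes "f \<in> coin \<rightarrow>\<^sub>M X" and "{x \<in> space X. P x} \<in> sets X" and "\<And>c. P (f c)"
  shows "AE x in distr coin X f. P x"
  using assms by (subst AE_distr_iff) auto

lemma Rn_eqI: "x \<in> space (Rn N) \<Longrightarrow> y \<in> space (Rn N) \<Longrightarrow> (\<And>i. i < N \<Longrightarrow> x i = y i) \<Longrightarrow> x = y"
  unfolding space_PiM by (rule PiE_ext) auto

lemma AE_shared_coin:
  assumes \<xi>: "range \<xi> \<subseteq> space (Rn N)" and \<eta>: "range \<eta> \<subseteq> space (Rn N)"
  shows "AE z in distr coin (Rn N \<Otimes>\<^sub>M Rn N) (\<lambda>c. (\<xi> c, \<eta> c)). \<exists>c. z = (\<xi> c, \<eta> c)"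
proof -
  \<comment> \<open>Equality with an atom is first stated coordinate by coordinate, where
    measurability of the event is immediate; extensionality then upgrades it to equality of
    vectors.\<close>
  have "AE z in distr coin (Rn N \<Otimes>\<^sub>M Rn N) (\<lambda>c. (\<xi> c, \<eta> c)).
      \<exists>c. \<forall>i\<in>{..<N}. fst z i = \<xi> c i \<and> snd z i = \<eta> c i"
  proof (rule AE_distr_coin)
    show "{z \<in> space (Rn N \<Otimes>\<^sub>M Rn N). \<exists>c. \<forall>i\<in>{..<N}. fst z i = \<xi> c i \<and> snd z i = \<eta> c i}
        \<in> sets (Rn N \<Otimes>\<^sub>M Rn N)"
      by measurable
  qed (use \<xi> \<eta> in \<open>auto simp: space_pair_measure\<close>)
  then show ?thesis
    using AE_space
  proof eventually_elim
    case (elim z)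
    then obtain c where c: "\<forall>i\<in>{..<N}. fst z i = \<xi> c i \<and> snd z i = \<eta> c i"
      by auto
    have "fst z \<in> space (Rn N)" "snd z \<in> space (Rn N)"
      using elim(2) by (auto simp: space_pair_measure)
    then have "fst z = \<xi> c" "snd z = \<eta> c"
      using c \<xi> \<eta> by (auto intro!: Rn_eqI)
    then show ?case
      by (metis prod.collapse)
  qed
qed

text \<open>At \<open>k = 0\<close> the joint kernel is the law of the two first coordinates under
  one coin, which has the right marginals. Afterwards each past reveals this same coin on its own,
  so the joint kernel is the Dirac mass at the pair and couples the two Dirac kernels.\<close>

lemma shared_coin_bicausal:
  assumes \<xi>: "range \<xi> \<subseteq> space (Rn N)" and \<xi>_ne: "\<xi> False 0 \<noteq> \<xi> True 0"
    and \<eta>: "range \<eta> \<subseteq> space (Rn N)" and \<eta>_ne: "\<eta> False 0 \<noteq> \<eta> True 0"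
  shows "distr coin (Rn N \<Otimes>\<^sub>M Rn N) (\<lambda>c. (\<xi> c, \<eta> c))
    \<in> bicausal_couplings N (two_point N \<xi>) (two_point N \<eta>)" (is "?\<pi> \<in> _")
proof -
  have meas: "(\<lambda>c. (\<xi> c, \<eta> c)) \<in> coin \<rightarrow>\<^sub>M Rn N \<Otimes>\<^sub>M Rn N"
    using \<xi> \<eta> by (auto simp: space_pair_measure)
  have "?\<pi> \<in> couplings (two_point N \<xi>) (two_point N \<eta>)"
  proof -
    have "sets ?\<pi> = sets (two_point N \<xi> \<Otimes>\<^sub>M two_point N \<eta>)"
      by (simp cong: sets_pair_measure_cong)
    moreover have "distr ?\<pi> (two_point N \<xi>) fst = two_point N \<xi>"
      "distr ?\<pi> (two_point N \<eta>) snd = two_point N \<eta>"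
      using meas by (simp_all add: distr_distr comp_def two_point_def cong: distr_cong)
    ultimately show ?thesis
      by (simp add: couplings_def)
  qed
  moreover have "AE (x, y) in ?\<pi>. two_point_kernel2 \<xi> \<eta> k (restrict x {..<k}, restrict y {..<k})
      \<in> couplings (two_point_kernel \<xi> k (restrict x {..<k})) (two_point_kernel \<eta> k (restrict y {..<k}))"
    for k
    using AE_shared_coin[OF \<xi> \<eta>]
  proof eventually_elim
    case (elim z)
    then obtain c where z: "z = (\<xi> c, \<eta> c)" by blast
    have eq: "(\<xi> c 0 = \<xi> True 0) = c" "(\<eta> c 0 = \<eta> True 0) = c"
      using \<xi>_ne \<eta>_ne by (cases c; auto)+
    show ?case
      by (auto simp: z eq couplings_def two_point_kernel_def two_point_kernel2_def
          distr_distr distr_return comp_def space_pair_measure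
          cong: distr_cong sets_pair_measure_cong)
  qed
  ultimately show ?thesis
    using disintegration_two_point[OF \<xi> \<xi>_ne] disintegration_two_point[OF \<eta> \<eta>_ne]
      disintegration2_two_point[OF \<xi> \<eta> \<xi>_ne]
    unfolding bicausal_couplings_def by blast
qed


section \<open>Costs of vectors that differ in one coordinate\<close>

definition unit_vec :: "nat \<Rightarrow> nat \<Rightarrow> nat \<Rightarrow> real" where
  "unit_vec N j = (\<lambda>i\<in>{..<N}. if i = j then 1 else 0)"

lemma unit_vec_in_space: "unit_vec N j \<in> space (Rn N)"
  by (simp add: unit_vec_def)

lemma is_norm_scale_unit:
  assumes "is_norm N nrm"
  shows "nrm (\<lambda>i\<in>{..<N}. c * unit_vec N j i) = \<bar>c\<bar> * nrm (unit_vec N j)"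
  using assms unit_vec_in_space unfolding is_norm_def by blast

text \<open>Nonnegativity comes from the triangle inequality for a vector and its negative: the zero
  vector has norm 0, and this is at most twice the norm of the vector. Definiteness makes it
  strict.\<close>

lemma is_norm_unit_pos:
  assumes nrm: "is_norm N nrm" and j: "j < N"
  shows "nrm (unit_vec N j) > 0"
proof -
  let ?e = "unit_vec N j"
  let ?m = "\<lambda>i\<in>{..<N}. (-1) * ?e i"
  have "nrm (\<lambda>i\<in>{..<N}. ?e i + ?m i) \<le> nrm ?e + nrm ?m"
    using nrm unit_vec_in_space restrict_in_space_Rn unfolding is_norm_def by blast
  moreover have "nrm (\<lambda>i\<in>{..<N}. ?e i + ?m i) = 0"
    using nrm unfolding is_norm_def by simp
  moreover have "nrm ?m = nrm ?e"
    using is_norm_scale_unit[OF nrm, of "-1" j] by simp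
  moreover have "nrm ?e \<noteq> 0"
  proof
    assume "nrm ?e = 0"
    then have "\<forall>i<N. ?e i = 0"
      using nrm unit_vec_in_space unfolding is_norm_def by blast
    then show False
      using j by (auto simp: unit_vec_def)
  qed
  ultimately show ?thesis by linarith
qed

text \<open>The difference is a multiple of a unit vector, so an arbitrary norm enters only through
  the constant \<open>nrm (unit_vec N j)\<close>.\<close>

lemma cost_single_coordinate:
  assumes nrm: "is_norm N nrm" and j: "j < N" and eq: "\<And>i. i < N \<Longrightarrow> i \<noteq> j \<Longrightarrow> x i = y i"
  shows "cost N nrm p x y =
    (if p = 0 then min (\<bar>x j - y j\<bar> * nrm (unit_vec N j)) 1 else \<bar>x j - y j\<bar> powr p)"
proof -
  have "(\<lambda>i\<in>{..<N}. x i - y i) = (\<lambda>i\<in>{..<N}. (x j - y j) * unit_vec N j i)"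
    using eq by (auto simp: fun_eq_iff unit_vec_def)
  moreover have "(\<Sum>i<N. \<bar>x i - y i\<bar> powr p) = (\<Sum>i\<in>{j}. \<bar>x i - y i\<bar> powr p)"
    using j eq by (intro sum.mono_neutral_right) auto
  ultimately show ?thesis
    by (simp add: cost_def is_norm_scale_unit[OF nrm])
qed

text \<open>Stated for a general probability space so that it serves both distances:
  \<open>M\<close> is a coupling for \<open>AW\<close> and the unit cube for \<open>KR\<close>. The
  maximum with 1 gives one constant for all admissible \<open>p\<close>.\<close>

lemma cost_root_integral_le:
  assumes p: "p = 0 \<or> 1 \<le> p" and nrm: "is_norm N nrm" and N: "0 < N" and M: "prob_space M" and t: "0 \<le> t"
    and ae: "AE w in M. (\<forall>i<N. i \<noteq> 0 \<longrightarrow> f w i = g w i) \<and> \<bar>f w 0 - g w 0\<bar> \<le> t"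
  shows "cost_root p (\<integral>\<^sup>+w. ennreal (cost N nrm p (f w) (g w)) \<partial>M)
    \<le> ennreal (max 1 (nrm (unit_vec N 0)) * t)"
proof -
  interpret prob_space M by fact
  let ?C = "max 1 (nrm (unit_vec N 0))"
  \<comment> \<open>No root is taken for \<open>p = 0\<close>, so the integrand is bounded linearly
    in \<open>t\<close>; otherwise the bound is a power whose root is \<open>t\<close>.\<close>
  let ?b = "if p = 0 then ?C * t else t powr p"
  have "AE w in M. ennreal (cost N nrm p (f w) (g w)) \<le> ennreal ?b"
    using ae
  proof eventually_elim
    case (elim w)
    have "nrm (unit_vec N 0) * \<bar>f w 0 - g w 0\<bar> \<le> ?C * t"
      using elim is_norm_unit_pos[OF nrm N] by (intro mult_mono) auto
    then have "\<bar>f w 0 - g w 0\<bar> * nrm (unit_vec N 0) \<le> ?C * t"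
      by (subst mult.commute)
    moreover have "\<bar>f w 0 - g w 0\<bar> powr p \<le> t powr p" if "1 \<le> p"
      using elim that by (intro powr_mono2) auto
    moreover have "cost N nrm p (f w) (g w) = (if p = 0 then min (\<bar>f w 0 - g w 0\<bar> * nrm (unit_vec N 0)) 1
        else \<bar>f w 0 - g w 0\<bar> powr p)"
      using elim by (intro cost_single_coordinate[OF nrm N]) blast
    ultimately have "cost N nrm p (f w) (g w) \<le> ?b"
      using p by (cases "p = 0") (simp_all only: if_True if_False min.coboundedI1 simp_thms)
    then show ?case
      by (rule ennreal_leI)
  qed
  then have "(\<integral>\<^sup>+w. ennreal (cost N nrm p (f w) (g w)) \<partial>M) \<le> (\<integral>\<^sup>+w. ennreal ?b \<partial>M)"
    by (rule nn_integral_mono_AE)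
  then have le: "(\<integral>\<^sup>+w. ennreal (cost N nrm p (f w) (g w)) \<partial>M) \<le> ennreal ?b" (is "?I \<le> _")
    by (simp add: emeasure_space_1)
  show ?thesis
  proof (cases "p = 0")
    case True
    then show ?thesis
      using le by (simp add: cost_root_def)
  next
    case False
    then have p1: "1 \<le> p"
      using p by simp
    \<comment> \<open>Finiteness excludes the infinite branch of \<open>cost_root\<close>.\<close>
    have fin: "?I \<noteq> \<infinity>"
      using le by (auto simp: top_unique)
    have "enn2real ?I \<le> t powr p"
      using enn2real_mono[OF le] False by simp
    then have "enn2real ?I powr (1 / p) \<le> (t powr p) powr (1 / p)"
      using p1 by (intro powr_mono2) auto
    also have "\<dots> = t"
      using p1 t by (simp add: powr_powr)
    also have "\<dots> \<le> ?C * t"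
      using mult_right_mono[OF max.cobounded1 t, of 1] by simp
    finally show ?thesis
      using False fin by (simp add: cost_root_def ennreal_leI)
  qed
qed

text \<open>The integrand is almost surely constant, and for \<open>p \<noteq> 0\<close> the
  constant is 1, which the root preserves. This supplies the lower bound on
  \<open>KR\<close>.\<close>

lemma cost_root_integral_unit_eq:
  assumes nrm: "is_norm N nrm" and j: "j < N" and M: "prob_space M"
    and ae: "AE w in M. (\<forall>i<N. i \<noteq> j \<longrightarrow> f w i = g w i) \<and> \<bar>f w j - g w j\<bar> = 1"
  shows "cost_root p (\<integral>\<^sup>+w. ennreal (cost N nrm p (f w) (g w)) \<partial>M)
    = ennreal (if p = 0 then min (nrm (unit_vec N j)) 1 else 1)"
proof -
  interpret prob_space M by fact
  have "AE w in M. ennreal (cost N nrm p (f w) (g w))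
      = ennreal (if p = 0 then min (nrm (unit_vec N j)) 1 else 1)"
    using ae
  proof eventually_elim
    case (elim w)
    then have "cost N nrm p (f w) (g w) = (if p = 0 then min (\<bar>f w j - g w j\<bar> * nrm (unit_vec N j)) 1
        else \<bar>f w j - g w j\<bar> powr p)"
      by (intro cost_single_coordinate[OF nrm j]) blast
    with elim show ?case
      by (simp only: mult_1 powr_one_eq_one)
  qed
  then have "(\<integral>\<^sup>+w. ennreal (cost N nrm p (f w) (g w)) \<partial>M)
      = (\<integral>\<^sup>+w. ennreal (if p = 0 then min (nrm (unit_vec N j)) 1 else 1) \<partial>M)"
    by (rule nn_integral_cong_AE)
  then show ?thesis
    by (simp add: emeasure_space_1 cost_root_def)
qed

section \<open>Finite moments and the adapted Wasserstein bound\<close>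

lemma prob_space_two_point: "range \<xi> \<subseteq> space (Rn N) \<Longrightarrow> prob_space (two_point N \<xi>)"
  unfolding two_point_def by (rule measure_pmf.prob_space_distr) auto

lemma two_point_in_prob_p:
  assumes "range \<xi> \<subseteq> space (Rn N)"
  shows "two_point N \<xi> \<in> prob_p N p"
proof -
  have "(\<integral>\<^sup>+x. ennreal (\<Sum>i<N. \<bar>x i\<bar> powr p) \<partial>two_point N \<xi>)
      = (\<integral>\<^sup>+c. ennreal (\<Sum>i<N. \<bar>\<xi> c i\<bar> powr p) \<partial>coin)"
    unfolding two_point_def using assms by (subst nn_integral_distr) auto
  also have "\<dots> < \<infinity>"
    by (simp add: nn_integral_pmf_of_set ennreal_divide_eq_top_iff less_top[symmetric] UNIV_bool)
  finally show ?thesis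
    using prob_space_two_point[OF assms] by (simp add: prob_p_def)
qed

text \<open>The shared-coin coupling is a competitor in the infimum, and under it only the first
  coordinates differ.\<close>

lemma AW_two_point_le:
  assumes p: "p = 0 \<or> 1 \<le> p" and nrm: "is_norm N nrm" and N: "0 < N"
    and \<xi>: "range \<xi> \<subseteq> space (Rn N)" and \<xi>_ne: "\<xi> False 0 \<noteq> \<xi> True 0"
    and \<eta>: "range \<eta> \<subseteq> space (Rn N)" and \<eta>_ne: "\<eta> False 0 \<noteq> \<eta> True 0"
    and eq: "\<And>c i. i < N \<Longrightarrow> i \<noteq> 0 \<Longrightarrow> \<xi> c i = \<eta> c i"
    and t: "\<And>c. \<bar>\<xi> c 0 - \<eta> c 0\<bar> \<le> t"
  shows "AW N nrm p (two_point N \<xi>) (two_point N \<eta>) \<le> ennreal (max 1 (nrm (unit_vec N 0)) * t)"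
proof -
  let ?\<pi> = "distr coin (Rn N \<Otimes>\<^sub>M Rn N) (\<lambda>c. (\<xi> c, \<eta> c))"
  have "AW N nrm p (two_point N \<xi>) (two_point N \<eta>)
      \<le> cost_root p (\<integral>\<^sup>+(x, y). ennreal (cost N nrm p x y) \<partial>?\<pi>)"
    unfolding AW_def by (rule INF_lower[OF shared_coin_bicausal[OF \<xi> \<xi>_ne \<eta> \<eta>_ne]])
  also have "\<dots> \<le> ennreal (max 1 (nrm (unit_vec N 0)) * t)"
    unfolding case_prod_unfold
  proof (rule cost_root_integral_le[OF p nrm N])
    show "prob_space ?\<pi>"
      using \<xi> \<eta> by (intro prob_space_distr_coin) (auto simp: space_pair_measure)
    show "0 \<le> t"
      using order_trans[OF abs_ge_zero t] .
    show "AE z in ?\<pi>. (\<forall>i<N. i \<noteq> 0 \<longrightarrow> fst z i = snd z i) \<and> \<bar>fst z 0 - snd z 0\<bar> \<le> t"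
      using AE_shared_coin[OF \<xi> \<eta>] by eventually_elim (use eq t in auto)
  qed
  finally show ?thesis .
qed

section \<open>Coordinates of the uniform law on the cube\<close>

abbreviation unif :: "real measure" where
  "unif \<equiv> restrict_space lborel {0<..<1}"

lemma emeasure_unif: "A \<in> sets borel \<Longrightarrow> A \<subseteq> {0<..<1} \<Longrightarrow> emeasure unif A = emeasure lborel A"
  by (simp add: emeasure_restrict_space)

lemma prob_space_unif: "prob_space unif"
  by (rule prob_spaceI) (simp add: space_restrict_space emeasure_unif)

lemma prob_space_unif_cube: "prob_space (unif_cube N)"
  unfolding unif_cube_def by (intro prob_space_PiM prob_space_unif)

lemma space_unif_cube: "space (unif_cube N) = {..<N} \<rightarrow>\<^sub>E {0<..<1}"
  by (simp add: unif_cube_def space_PiM space_restrict_space)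

lemma measurable_unif_cube_component [measurable]:
  "i < N \<Longrightarrow> (\<lambda>u. u i) \<in> unif_cube N \<rightarrow>\<^sub>M borel"
  unfolding unif_cube_def
  by (rule measurable_compose[OF measurable_component_singleton[of i "{..<N}"]])
    (auto simp: measurable_restrict_space1)

lemma emeasure_unif_cube_component:
  assumes "i < N" and "A \<in> sets borel" and "A \<subseteq> {0<..<1}"
  shows "emeasure (unif_cube N) {u \<in> space (unif_cube N). u i \<in> A} = emeasure lborel A"
proof -
  have A: "A \<in> sets unif"
    using assms by (simp add: sets_restrict_space_iff)
  have "emeasure lborel A = emeasure (distr (unif_cube N) unif (\<lambda>u. u i)) A"
    unfolding unif_cube_def using assms
    by (subst distr_PiM_component) (auto simp: prob_space_unif emeasure_unif)
  also have "\<dots> = emeasure (unif_cube N) ((\<lambda>u. u i) -` A \<inter> space (unif_cube N))"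
    using A assms(1) by (intro emeasure_distr) (auto simp: unif_cube_def)
  finally show ?thesis
    by (simp add: vimage_def Int_def conj_commute)
qed

lemma emeasure_unif_cube_less:
  assumes "i < N" and "0 < t" and "t < 1"
  shows "emeasure (unif_cube N) {u \<in> space (unif_cube N). u i < t} = t"
proof -
  have "{u \<in> space (unif_cube N). u i < t} = {u \<in> space (unif_cube N). u i \<in> {0<..<t}}"
    using assms by (auto simp: space_unif_cube PiE_iff)
  then show ?thesis
    using assms by (simp only:) (subst emeasure_unif_cube_component, auto)
qed

lemma emeasure_unif_cube_greater:
  assumes "i < N" and "0 < t" and "t < 1"
  shows "emeasure (unif_cube N) {u \<in> space (unif_cube N). t < u i} = ennreal (1 - t)"
proof -
  have "{u \<in> space (unif_cube N). t < u i} = {u \<in> space (unif_cube N). u i \<in> {t<..<1}}"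
    using assms by (auto simp: space_unif_cube PiE_iff)
  then show ?thesis
    using assms by (simp only:) (subst emeasure_unif_cube_component, auto)
qed

lemma AE_unif_cube_component_neq:
  assumes "i < N" and "0 < t" and "t < 1"
  shows "AE u in unif_cube N. u i \<noteq> t"
proof (rule AE_I)
  show "emeasure (unif_cube N) {u \<in> space (unif_cube N). u i \<in> {t}} = 0"
    using assms by (subst emeasure_unif_cube_component) auto
  show "{u \<in> space (unif_cube N). u i \<in> {t}} \<in> sets (unif_cube N)"
    using assms(1) by measurable
qed auto

lemma emeasure_coin_singleton: "emeasure coin {c} = ennreal (1 / 2)"
  by (simp add: emeasure_pmf_of_set)

section \<open>The quantile process of a two-point law\<close>

text \<open>The process jumps from the lower to the upper atom when \<open>u 0\<close> passes 1/2.
  Condition (con) holds because equal first coordinates mean equal atoms, and coordinates of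
  \<open>u\<close> after the first have no influence.\<close>

lemma quantile_process_two_point:
  assumes N: "0 < N" and \<xi>: "range \<xi> \<subseteq> space (Rn N)" and less: "\<xi> False 0 < \<xi> True 0"
  shows "quantile_process N (\<lambda>u. \<xi> (1 / 2 < u 0))"
    and "distr (unif_cube N) (Rn N) (\<lambda>u. \<xi> (1 / 2 < u 0)) = two_point N \<xi>"
proof -
  have coin_meas: "(\<lambda>u. 1 / 2 < u 0) \<in> unif_cube N \<rightarrow>\<^sub>M count_space UNIV"
    using N by measurable
  have \<xi>_meas: "\<xi> \<in> count_space UNIV \<rightarrow>\<^sub>M Rn N"
    using \<xi> by auto
  have mono: "\<xi> b 0 \<le> \<xi> c 0" if "b \<longrightarrow> c" for b c
    using that less by (cases b; cases c) auto
  have inj: "b = c" if "\<xi> b 0 = \<xi> c 0" for b c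
    using that less by (cases b; cases c) auto
  have "triangular N (\<lambda>u. \<xi> (1 / 2 < u 0))"
    unfolding triangular_def using measurable_compose[OF coin_meas \<xi>_meas] by simp
  then show "quantile_process N (\<lambda>u. \<xi> (1 / 2 < u 0))"
    unfolding quantile_process_def by (auto intro: mono dest: inj)
  have "distr (unif_cube N) (count_space UNIV) (\<lambda>u. 1 / 2 < u 0) = coin"
  proof (rule measure_eqI_countable[where A=UNIV])
    fix c :: bool
    have half: "emeasure (unif_cube N) {u \<in> space (unif_cube N). (1 / 2 < u 0) = c} = ennreal (1 / 2)"
    proof (cases c)
      case True
      then show ?thesis
        using emeasure_unif_cube_greater[OF N, of "1 / 2"] by simp
    next
      case False
      \<comment> \<open>The event is \<open>u 0 \<le> 1 / 2\<close>; it differs from the strict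
        inequality by a null set.\<close>
      have "emeasure (unif_cube N) {u \<in> space (unif_cube N). (1 / 2 < u 0) = c}
          = emeasure (unif_cube N) {u \<in> space (unif_cube N). u 0 < 1 / 2}"
      proof (rule emeasure_eq_AE)
        show "AE u in unif_cube N. (u \<in> {u \<in> space (unif_cube N). (1 / 2 < u 0) = c})
            = (u \<in> {u \<in> space (unif_cube N). u 0 < 1 / 2})"
          using AE_unif_cube_component_neq[OF N, of "1 / 2"] False by (auto elim!: AE_mp)
      qed (use N in measurable)
      then show ?thesis
        using emeasure_unif_cube_less[OF N, of "1 / 2"] by simp
    qed
    have "emeasure (distr (unif_cube N) (count_space UNIV) (\<lambda>u. 1 / 2 < u 0)) {c}
        = emeasure (unif_cube N) ((\<lambda>u. 1 / 2 < u 0) -` {c} \<inter> space (unif_cube N))"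
      by (rule emeasure_distr[OF coin_meas]) simp
    also have "\<dots> = emeasure (unif_cube N) {u \<in> space (unif_cube N). (1 / 2 < u 0) = c}"
      by (rule arg_cong2[where f=emeasure]) auto
    finally show "emeasure (distr (unif_cube N) (count_space UNIV) (\<lambda>u. 1 / 2 < u 0)) {c} = emeasure coin {c}"
      unfolding half emeasure_coin_singleton .
  qed auto
  then have "two_point N \<xi> = distr (distr (unif_cube N) (count_space UNIV) (\<lambda>u. 1 / 2 < u 0)) (Rn N) \<xi>"
    by (simp add: two_point_def)
  then show "distr (unif_cube N) (Rn N) (\<lambda>u. \<xi> (1 / 2 < u 0)) = two_point N \<xi>"
    unfolding distr_distr[OF \<xi>_meas coin_meas] comp_def by (rule sym)
qed

text \<open>The definition of \<open>quantile_of\<close> selects an unspecified version, so every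
  version has to be identified. The first coordinate is increasing in \<open>u 0\<close> and each
  atom has mass 1/2, which forces the jump at 1/2; the first coordinate then determines the
  atom.\<close>

lemma quantile_process_two_point_unique:
  assumes N: "0 < N" and \<xi>: "range \<xi> \<subseteq> space (Rn N)" and less: "\<xi> False 0 < \<xi> True 0"
    and Q: "quantile_process N Q" and law: "distr (unif_cube N) (Rn N) Q = two_point N \<xi>"
  shows "AE u in unif_cube N. Q u = \<xi> (1 / 2 < u 0)"
proof -
  have Q_meas: "Q \<in> unif_cube N \<rightarrow>\<^sub>M Rn N"
    using Q unfolding quantile_process_def triangular_def by blast
  have [measurable]: "(\<lambda>u. Q u 0) \<in> unif_cube N \<rightarrow>\<^sub>M borel"
    using N by (intro measurable_compose[OF Q_meas measurable_component_singleton]) auto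
  \<comment> \<open>Condition (inc) moves coordinate 0 from \<open>u 0\<close> to
    \<open>v 0\<close>; triangularity makes the remaining coordinates irrelevant.\<close>
  have Q_mono: "Q u 0 \<le> Q v 0"
    if u: "u \<in> space (unif_cube N)" and v: "v \<in> space (unif_cube N)" and "u 0 \<le> v 0" for u v
  proof -
    have v0: "v 0 \<in> {0<..<1}"
      using PiE_mem[OF v[unfolded space_unif_cube], of 0] N by simp
    have mem: "u(0 := v 0) \<in> space (unif_cube N)"
      using u v0 N by (auto simp: space_unif_cube PiE_iff extensional_def)
    have "Q u 0 \<le> Q (u(0 := v 0)) 0"
      using Q N u v0 \<open>u 0 \<le> v 0\<close> unfolding quantile_process_def by blast
    moreover have "\<forall>i\<le>0. (u(0 := v 0)) i = v i"
      by simp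
    then have "Q (u(0 := v 0)) 0 = Q v 0"
      using Q N mem v unfolding quantile_process_def triangular_def by blast
    ultimately show ?thesis by simp
  qed
  have law_half: "emeasure (unif_cube N) {u \<in> space (unif_cube N). Q u 0 \<in> A} = ennreal (1 / 2)"
    if "A \<in> sets borel" and "{d. \<xi> d 0 \<in> A} = {c}" for A c
  proof -
    have [measurable]: "(\<lambda>x. x 0) \<in> Rn N \<rightarrow>\<^sub>M borel"
      using N by (intro measurable_component_singleton) auto
    have A: "{x \<in> space (Rn N). x 0 \<in> A} \<in> sets (Rn N)"
      using that(1) by measurable
    have "emeasure (unif_cube N) {u \<in> space (unif_cube N). Q u 0 \<in> A}
        = emeasure (distr (unif_cube N) (Rn N) Q) {x \<in> space (Rn N). x 0 \<in> A}"
      using measurable_space[OF Q_meas]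
      by (subst emeasure_distr[OF Q_meas A]) (auto intro!: arg_cong2[where f=emeasure])
    also have "\<dots> = emeasure coin {d. \<xi> d 0 \<in> A}"
      unfolding law two_point_def using \<xi>
      by (subst emeasure_distr[OF _ A]) (auto intro!: arg_cong2[where f=emeasure])
    finally show ?thesis
      using that(2) by (simp add: emeasure_coin_singleton)
  qed
  \<comment> \<open>Otherwise monotonicity puts the whole event \<open>v 0 < u 0\<close>, of mass
    above 1/2, into a set of mass exactly 1/2. The bound \<open>lower\<close> is the mirror
    image.\<close>
  have upper: "\<xi> False 0 < Q u 0" if u: "u \<in> space (unif_cube N)" and "1 / 2 < u 0" for u
  proof (rule ccontr)
    assume *: "\<not> \<xi> False 0 < Q u 0"
    have "ennreal (u 0) = emeasure (unif_cube N) {v \<in> space (unif_cube N). v 0 < u 0}"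
      using u N \<open>1 / 2 < u 0\<close> by (subst emeasure_unif_cube_less) (auto simp: space_unif_cube PiE_iff)
    also have "\<dots> \<le> emeasure (unif_cube N) {v \<in> space (unif_cube N). Q v 0 \<in> {..\<xi> False 0}}"
    proof (rule emeasure_mono)
      show "{v \<in> space (unif_cube N). v 0 < u 0} \<subseteq> {v \<in> space (unif_cube N). Q v 0 \<in> {..\<xi> False 0}}"
        using Q_mono[OF _ u] * by fastforce
    qed (use N in measurable)
    also have "\<dots> = ennreal (1 / 2)"
    proof (rule law_half)
      have "d \<in> {d. \<xi> d 0 \<in> {..\<xi> False 0}} \<longleftrightarrow> d \<in> {False}" for d
        using less by (cases d) auto
      then show "{d. \<xi> d 0 \<in> {..\<xi> False 0}} = {False}"
        by blast
    qed simp
    finally show False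
      using \<open>1 / 2 < u 0\<close> by (subst (asm) ennreal_le_iff) auto
  qed
  have lower: "Q u 0 < \<xi> True 0" if u: "u \<in> space (unif_cube N)" and "u 0 < 1 / 2" for u
  proof (rule ccontr)
    assume *: "\<not> Q u 0 < \<xi> True 0"
    have "ennreal (1 - u 0) = emeasure (unif_cube N) {v \<in> space (unif_cube N). u 0 < v 0}"
      using u N \<open>u 0 < 1 / 2\<close> by (subst emeasure_unif_cube_greater) (auto simp: space_unif_cube PiE_iff)
    also have "\<dots> \<le> emeasure (unif_cube N) {v \<in> space (unif_cube N). Q v 0 \<in> {\<xi> True 0..}}"
    proof (rule emeasure_mono)
      show "{v \<in> space (unif_cube N). u 0 < v 0} \<subseteq> {v \<in> space (unif_cube N). Q v 0 \<in> {\<xi> True 0..}}"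
        using Q_mono[OF u] * by fastforce
    qed (use N in measurable)
    also have "\<dots> = ennreal (1 / 2)"
    proof (rule law_half)
      have "d \<in> {d. \<xi> d 0 \<in> {\<xi> True 0..}} \<longleftrightarrow> d \<in> {True}" for d
        using less by (cases d) auto
      then show "{d. \<xi> d 0 \<in> {\<xi> True 0..}} = {True}"
        by blast
    qed simp
    finally show False
      using \<open>u 0 < 1 / 2\<close> by (subst (asm) ennreal_le_iff) auto
  qed
  \<comment> \<open>Since \<open>Q\<close> almost surely hits one of the two atoms, the strict
    bounds \<open>upper\<close> and \<open>lower\<close> leave only one choice on either side of
    1/2.\<close>
  have "AE x in two_point N \<xi>. \<exists>c. \<forall>i\<in>{..<N}. x i = \<xi> c i"
    unfolding two_point_def
  proof (rule AE_distr_coin)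
    show "{x \<in> space (Rn N). \<exists>c. \<forall>i\<in>{..<N}. x i = \<xi> c i} \<in> sets (Rn N)"
      by measurable
  qed (use \<xi> in auto)
  then have "AE u in unif_cube N. \<exists>c. \<forall>i\<in>{..<N}. Q u i = \<xi> c i"
    unfolding law[symmetric] by (rule AE_distrD[OF Q_meas])
  moreover have "AE u in unif_cube N. u 0 \<noteq> 1 / 2"
    by (rule AE_unif_cube_component_neq[OF N]) simp_all
  ultimately show ?thesis
    using AE_space
  proof eventually_elim
    case (elim u)
    then obtain c where c: "\<forall>i\<in>{..<N}. Q u i = \<xi> c i"
      by auto
    have "c = (1 / 2 < u 0)"
    proof (cases "1 / 2 < u 0")
      case True
      then show ?thesis
        using upper[OF elim(3)] c N by (cases c) auto
    next
      case False
      then show ?thesis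
        using lower[OF elim(3)] c N elim(2) by (cases c) auto
    qed
    then show ?case
      using c \<xi> measurable_space[OF Q_meas elim(3)] by (auto intro!: Rn_eqI)
  qed
qed

lemma quantile_of_two_point:
  assumes "0 < N" and "range \<xi> \<subseteq> space (Rn N)" and "\<xi> False 0 < \<xi> True 0"
  shows "AE u in unif_cube N. quantile_of N (two_point N \<xi>) u = \<xi> (1 / 2 < u 0)"
proof -
  have "\<exists>Q. quantile_process N Q \<and> distr (unif_cube N) (Rn N) Q = two_point N \<xi>"
    using quantile_process_two_point[OF assms] by blast
  from someI_ex[OF this] show ?thesis
    unfolding quantile_of_def by (intro quantile_process_two_point_unique[OF assms]) auto
qed

section \<open>Distances within the family with two orders, and the alternating sequence\<close>

text \<open>
  \<open>c\<close> tells whether the first coordinate is the larger one, \<open>b\<close> which of the two atoms has second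
  coordinate 1.
\<close>

definition atoms :: "nat \<Rightarrow> real \<Rightarrow> bool \<Rightarrow> bool \<Rightarrow> nat \<Rightarrow> real" where
  "atoms N e b c = (\<lambda>i\<in>{..<N}. if i = 0 then (if c then e else 0)
     else if i = 1 then of_bool (c = b) else 0)"

lemma range_atoms: "range (atoms N e b) \<subseteq> space (Rn N)"
  by (auto simp: atoms_def)

text \<open>The crude bound by the sum \<open>a m + a n\<close> suffices, because the gaps between
  first coordinates tend to 0.\<close>

lemma cauchy_wrtI:
  fixes a :: "nat \<Rightarrow> real"
  assumes a: "a \<longlonglongrightarrow> 0" and C: "0 < C" and d: "\<And>m n. d (X m) (X n) \<le> ennreal (C * (a m + a n))"
  shows "cauchy_wrt d X"
  unfolding cauchy_wrt_def
proof (intro allI impI)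
  fix \<epsilon> :: real assume "0 < \<epsilon>"
  then have "\<forall>\<^sub>F n in sequentially. a n < \<epsilon> / (2 * C)"
    using a C by (intro order_tendstoD(2)[OF a]) simp
  then obtain M where M: "\<And>n. M \<le> n \<Longrightarrow> a n < \<epsilon> / (2 * C)"
    by (auto simp: eventually_sequentially)
  have "d (X m) (X n) < ennreal \<epsilon>" if "M \<le> m" "M \<le> n" for m n
  proof -
    have "C * (a m + a n) < C * (\<epsilon> / (2 * C) + \<epsilon> / (2 * C))"
      using M[OF that(1)] M[OF that(2)] C by (intro mult_strict_left_mono add_strict_mono)
    also have "\<dots> = \<epsilon>"
      using C by (simp add: field_simps)
    finally have "ennreal (C * (a m + a n)) < ennreal \<epsilon>"
      using \<open>0 < \<epsilon>\<close> by (intro ennreal_lessI)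
    with d show ?thesis
      by (rule le_less_trans)
  qed
  then show "\<exists>M. \<forall>m\<ge>M. \<forall>n\<ge>M. d (X m) (X n) < ennreal \<epsilon>"
    by blast
qed

context
  fixes p :: real and N :: nat and nrm :: "(nat \<Rightarrow> real) \<Rightarrow> real"
  assumes p: "p = 0 \<or> 1 \<le> p" and N: "2 \<le> N" and nrm: "is_norm N nrm"
begin

lemma AW_atoms_le:
  assumes "0 < d" "0 < e"
  shows "AW N nrm p (two_point N (atoms N d b)) (two_point N (atoms N e b'))
    \<le> ennreal (max 1 (nrm (unit_vec N 0)) * (d + e))"
proof -
  \<comment> \<open>The coin is flipped exactly when the orders differ. The second coordinate of
    \<open>\<eta> c\<close> is then \<open>of_bool (c = b)\<close> in both cases, as for
    \<open>atoms N d b c\<close>.\<close>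
  define \<eta> where "\<eta> = (\<lambda>c. atoms N e b' (c = (b = b')))"
  have eq: "two_point N \<eta> = two_point N (atoms N e b')"
    using two_point_Not[OF range_atoms, of N e b'] by (cases "b = b'") (auto simp: \<eta>_def)
  have "AW N nrm p (two_point N (atoms N d b)) (two_point N \<eta>)
      \<le> ennreal (max 1 (nrm (unit_vec N 0)) * (d + e))"
    using p nrm N assms
    by (intro AW_two_point_le range_atoms) (auto simp: \<eta>_def atoms_def)
  then show ?thesis
    by (simp add: eq)
qed

lemma AE_quantile_of_atoms:
  "0 < e \<Longrightarrow> AE u in unif_cube N. quantile_of N (two_point N (atoms N e b)) u = atoms N e b (1 / 2 < u 0)"
  using N by (intro quantile_of_two_point range_atoms) (auto simp: atoms_def)

text \<open>Both quantile processes switch atoms at 1/2. With the same order \<open>b\<close> their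
  second coordinates therefore agree, and only the gaps contribute.\<close>

lemma KR_atoms_le:
  assumes "0 < d" "0 < e"
  shows "KR N nrm p (two_point N (atoms N d b)) (two_point N (atoms N e b))
    \<le> ennreal (max 1 (nrm (unit_vec N 0)) * (d + e))"
  unfolding KR_def
proof (rule cost_root_integral_le[OF p nrm _ prob_space_unif_cube])
  show "AE u in unif_cube N.
      (\<forall>i<N. i \<noteq> 0 \<longrightarrow> quantile_of N (two_point N (atoms N d b)) u i = quantile_of N (two_point N (atoms N e b)) u i) \<and>
      \<bar>quantile_of N (two_point N (atoms N d b)) u 0 - quantile_of N (two_point N (atoms N e b)) u 0\<bar> \<le> d + e"
    using AE_quantile_of_atoms[OF assms(1), of b] AE_quantile_of_atoms[OF assms(2), of b]
    by eventually_elim (use N assms in \<open>auto simp: atoms_def\<close>)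
qed (use N assms in auto)

text \<open>With a common gap the first coordinates coincide, while the forced matching pairs second
  coordinates 0 and 1. The resulting value does not depend on \<open>e\<close>.\<close>

lemma KR_atoms_opposite:
  assumes "0 < e"
  shows "KR N nrm p (two_point N (atoms N e True)) (two_point N (atoms N e False))
    = ennreal (if p = 0 then min (nrm (unit_vec N 1)) 1 else 1)"
  unfolding KR_def
proof (rule cost_root_integral_unit_eq[OF nrm _ prob_space_unif_cube])
  show "AE u in unif_cube N.
      (\<forall>i<N. i \<noteq> 1 \<longrightarrow> quantile_of N (two_point N (atoms N e True)) u i = quantile_of N (two_point N (atoms N e False)) u i) \<and>
      \<bar>quantile_of N (two_point N (atoms N e True)) u 1 - quantile_of N (two_point N (atoms N e False)) u 1\<bar> = 1"
    using AE_quantile_of_atoms[OF assms, of True] AE_quantile_of_atoms[OF assms, of False]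
    by eventually_elim (use N in \<open>auto simp: atoms_def\<close>)
qed (use N in auto)

end

theorem proposition4p8:
  fixes p :: real and N :: nat and nrm :: "(nat \<Rightarrow> real) \<Rightarrow> real"
  assumes "p = 0 \<or> 1 \<le> p"
    and "2 \<le> N"
    and "is_norm N nrm"
  shows "\<exists>\<mu> :: nat \<Rightarrow> (nat \<Rightarrow> real) measure.
    (\<forall>n. \<mu> n \<in> prob_p N p) \<and>
    cauchy_wrt (AW N nrm p) \<mu> \<and>
    \<not> cauchy_wrt (KR N nrm p) \<mu> \<and>
    (\<exists>r s. strict_mono r \<and> strict_mono s \<and>
       cauchy_wrt (KR N nrm p) (\<mu> \<circ> r) \<and>
       cauchy_wrt (KR N nrm p) (\<mu> \<circ> s) \<and>
       \<not> (\<lambda>n. KR N nrm p (\<mu> (r n)) (\<mu> (s n))) \<longlonglongrightarrow> 0)"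
proof -
  define a :: "nat \<Rightarrow> real" where "a n = inverse (real (Suc n))" for n
  \<comment> \<open>Halving the index gives the terms \<open>2 * n\<close> and
    \<open>2 * n + 1\<close> the same gap \<open>a n\<close> and opposite orders, so that their
    \<open>KR\<close> distance is exactly \<delta>.\<close>
  define \<mu> where "\<mu> n = two_point N (atoms N (a (n div 2)) (even n))" for n
  define r s :: "nat \<Rightarrow> nat" where "r n = 2 * n" and "s n = Suc (2 * n)" for n
  define C where "C = max 1 (nrm (unit_vec N 0))"
  define \<delta> where "\<delta> = (if p = 0 then min (nrm (unit_vec N 1)) 1 else 1)"
  have C: "0 < C"
    by (simp add: C_def)
  have \<delta>: "0 < \<delta>"
    using is_norm_unit_pos[OF assms(3), of 1] assms(2) by (simp add: \<delta>_def)
  have a_pos: "0 < a n" for n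
    by (simp add: a_def)
  have a_lim: "a \<longlonglongrightarrow> 0"
    unfolding a_def by (rule LIMSEQ_inverse_real_of_nat)
  have \<mu>_r: "\<mu> (r n) = two_point N (atoms N (a n) True)"
    and \<mu>_s: "\<mu> (s n) = two_point N (atoms N (a n) False)" for n
    by (simp_all add: \<mu>_def r_def s_def)
  have KR_rs: "KR N nrm p (\<mu> (r n)) (\<mu> (s n)) = ennreal \<delta>" for n
    unfolding \<mu>_r \<mu>_s \<delta>_def by (rule KR_atoms_opposite[OF assms a_pos])
  have "(\<lambda>n. a (n div 2)) \<longlonglongrightarrow> 0"
  proof (rule filterlim_compose[OF a_lim])
    have "\<forall>\<^sub>F n in sequentially. Z \<le> n div 2" for Z :: nat
      by (rule eventually_sequentiallyI[of "2 * Z"]) simp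
    then show "filterlim (\<lambda>n :: nat. n div 2) sequentially sequentially"
      by (simp add: filterlim_at_top)
  qed
  then have "cauchy_wrt (AW N nrm p) \<mu>"
    \<comment> \<open>The bound on \<open>AW\<close> holds for any pair of orders, so the
      alternation does no harm.\<close>
    by (rule cauchy_wrtI[OF _ C]) (unfold \<mu>_def C_def, rule AW_atoms_le[OF assms a_pos a_pos])
  moreover have "cauchy_wrt (KR N nrm p) (\<mu> \<circ> r)" "cauchy_wrt (KR N nrm p) (\<mu> \<circ> s)"
    by (rule cauchy_wrtI[OF a_lim C], unfold comp_def \<mu>_r \<mu>_s C_def, rule KR_atoms_le[OF assms a_pos a_pos])+
  moreover have "\<not> cauchy_wrt (KR N nrm p) \<mu>"
  proof
    assume "cauchy_wrt (KR N nrm p) \<mu>"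
    then obtain M where M: "\<And>m n. M \<le> m \<Longrightarrow> M \<le> n \<Longrightarrow> KR N nrm p (\<mu> m) (\<mu> n) < ennreal \<delta>"
      using \<delta> unfolding cauchy_wrt_def by blast
    have "KR N nrm p (\<mu> (r M)) (\<mu> (s M)) < ennreal \<delta>"
      by (rule M) (simp_all add: r_def s_def)
    then show False
      by (simp add: KR_rs)
  qed
  \<comment> \<open>The two subsequences stay at constant distance \<delta>, so they are genuinely
    different Cauchy sequences and not two pieces of one.\<close>
  moreover have "\<not> (\<lambda>n. KR N nrm p (\<mu> (r n)) (\<mu> (s n))) \<longlonglongrightarrow> 0"
    using \<delta> by (simp add: KR_rs LIMSEQ_const_iff)
  moreover have "\<mu> n \<in> prob_p N p" for n
    unfolding \<mu>_def by (rule two_point_in_prob_p[OF range_atoms])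
  moreover have "strict_mono r" "strict_mono s"
    by (simp_all add: strict_mono_def r_def s_def)
  ultimately show ?thesis
    by blast
qed

end
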